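(* For every height $h\ge1$, the extended binary tree network $\hat\Sigma$ of height $h$, i.e. the structured system $(\hat A,\hat B,\hat C)$ defined in the context, is structurally output controllable.
   Context: **Structural output controllability.** A structured linear system $\dot{\hat x}=\hat A\hat x+\hat Bu$, $\hat y=\hat C\hat x$ with state dimension $\hat n$, whose matrix entries are either fixed or free (generic, independent, arbitrary real) parameters, is structurally output controllable if for some choice of the free parameters the matrix $\hat C[\hat B\ \hat A\hat B\ \cdots\ \hat A^{\hat n-1}\hat B]$ has full row rank. **Binary tree network of height $h$.** The original network has $n=2^{h+1}-1$ first-order subsystems $1,\dots,n$ arranged as a complete binary tree, labeled level by level. The root is $1$; each $j\in\{1,\dots,2^h-1\}$ has the two children $2j$ and $2j+1$, with edges $(j,2j),(j,2j+1)$ directed from parent to child (the edge set is denoted $\mathcal E_v$). The leaves are $2^h,\dots,2^{h+1}-1$. There is a single scalar input $u$ acting on the root only. **Extended binary tree network.** Every non-leaf subsystem $i\in\{1,\dots,2^h-1\}$ is replaced with a second-order heterogeneous subsystem, with two states $\hat x_i\in\mathbb{R}^2$; each leaf keeps one state and zero internal dynamics. The state dimension is $\hat n=2(2^h-1)+2^h$, with states ordered by subsystem. Below, $\star$ denotes a free parameter (distinct occurrences are independent). The state matrix is $$\hat A=\begin{bmatrix}A^{(1)}&0\\ A^{(2)}&0\end{bmatrix},\qquad A^{(2)}=[\,0\ \ I_\star\,]\in\mathbb{R}^{2^h\times(2^{h+1}-2)},$$ where $I_\star$ is a $2^h\times2^h$ diagonal matrix with free diagonal entries (so the leaves are driven,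 one each, by the $2^h$ states of the last level of non-leaf subsystems). The matrix $A^{(1)}\in\mathbb{R}^{(2^{h+1}-2)\times(2^{h+1}-2)}$ is partitioned into $2\times2$ blocks $A^{(1)}_{ij}$, $i,j\in\{1,\dots,2^h-1\}$, with $$A^{(1)}_{ij}=\begin{cases}\begin{bmatrix}\star&\star\\ \star&\star\end{bmatrix}& i=j,\\[2mm] \begin{bmatrix}\star&0\\0&0\end{bmatrix}& i=\min\{k:(j,k)\in\mathcal E_v\}=2j,\\[2mm] \begin{bmatrix}0&\star\\0&0\end{bmatrix}& i=\max\{k:(j,k)\in\mathcal E_v\}=2j+1,\\[2mm] 0&\text{otherwise.}\end{cases}$$ The input matrix $\hat B\in\mathbb{R}^{\hat n\times1}$ has block $\hat b_1\in\mathbb{R}^2$ with free entries and $\hat b_i=0$ for $i\neq1$. The output matrix is $\hat C=\mathrm{diag}(\hat c_1,\dots,\hat c_n)\in\mathbb{R}^{n\times\hat n}$, with $\hat c_i\in\mathbb{R}^{1\times2}$ having free entries for $i\in\{1,\dots,2^h-1\}$ and $\hat c_i=1$ for the leaves. *)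

theory Defs
  imports "Jordan_Normal_Form.DL_Rank"
begin

section \<open>Structured systems and output controllability\<close>

text \<open>A structured matrix has entries that are either fixed reals or free parameters; every
  occurrence of \<open>Free\<close> is a parameter of its own.\<close>

datatype sentry = Fixed real | Free

definition realizations :: "sentry mat \<Rightarrow> real mat set" where
  "realizations S = {M \<in> carrier_mat (dim_row S) (dim_col S).
     \<forall>i < dim_row S. \<forall>j < dim_col S. \<forall>c. S $$ (i, j) = Fixed c \<longrightarrow> M $$ (i, j) = c}"

text \<open>\<open>[B, A B, \<dots>, A\<^sup>n\<^sup>-\<^sup>1 B]\<close> for \<open>A\<close> of size \<open>n \<times> n\<close> and \<open>B\<close> of size \<open>n \<times> m\<close>: column
  \<open>k * m + l\<close> is column \<open>l\<close> of \<open>A\<^sup>k B\<close>.\<close>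

definition controllability_mat :: "real mat \<Rightarrow> real mat \<Rightarrow> real mat" where
  "controllability_mat A B = (let n = dim_row A; m = dim_col B in
     mat n (n * m) (\<lambda>(i, c). (A ^\<^sub>m (c div m) * B) $$ (i, c mod m)))"

definition full_row_rank :: "real mat \<Rightarrow> bool" where
  "full_row_rank M \<longleftrightarrow> vec_space.rank (dim_row M) M = dim_row M"

definition structurally_output_controllable :: "sentry mat \<Rightarrow> sentry mat \<Rightarrow> sentry mat \<Rightarrow> bool" where
  "structurally_output_controllable SA SB SC \<longleftrightarrow>
     (\<exists>A \<in> realizations SA. \<exists>B \<in> realizations SB. \<exists>C \<in> realizations SC.
        full_row_rank (C * controllability_mat A B))"


section \<open>The extended binary tree network\<close>

text \<open>Subsystems carry the labels \<open>1, \<dots>, 2\<^sup>h\<^sup>+\<^sup>1 - 1\<close>, whereas matrix indices start at \<open>0\<close>.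
  The states of the non-leaf subsystem \<open>i\<close> have indices \<open>2 * (i - 1)\<close> and \<open>2 * (i - 1) + 1\<close>,
  so the state with index \<open>r\<close> belongs to subsystem \<open>r div 2 + 1\<close>; the states of the leaves follow.\<close>

definition tree_edges :: "nat \<Rightarrow> (nat \<times> nat) set" where
  "tree_edges h = {(j, k). j \<in> {1..2 ^ h - 1} \<and> k \<in> {2 * j, 2 * j + 1}}"

lemma Min_children: "j \<in> {1..2 ^ h - 1} \<Longrightarrow> Min {k. (j, k) \<in> tree_edges h} = 2 * j"
  and Max_children: "j \<in> {1..2 ^ h - 1} \<Longrightarrow> Max {k. (j, k) \<in> tree_edges h} = 2 * j + 1"
proof -
  assume "j \<in> {1..2 ^ h - 1}"
  then have "{k. (j, k) \<in> tree_edges h} = {2 * j, 2 * j + 1}"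
    by (auto simp: tree_edges_def)
  then show "Min {k. (j, k) \<in> tree_edges h} = 2 * j"
    and "Max {k. (j, k) \<in> tree_edges h} = 2 * j + 1" by simp_all
qed

definition A1_block :: "nat \<Rightarrow> nat \<Rightarrow> nat \<Rightarrow> sentry mat" where
  "A1_block h i j =
    (if i = j then
       mat_of_rows_list 2 [[Free, Free], [Free, Free]]
     else if i = Min {k. (j, k) \<in> tree_edges h} then
       mat_of_rows_list 2 [[Free, Fixed 0], [Fixed 0, Fixed 0]]
     else if i = Max {k. (j, k) \<in> tree_edges h} then
       mat_of_rows_list 2 [[Fixed 0, Free], [Fixed 0, Fixed 0]]
     else
       mat_of_rows_list 2 [[Fixed 0, Fixed 0], [Fixed 0, Fixed 0]])"

definition A1_mat :: "nat \<Rightarrow> sentry mat" where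
  "A1_mat h = mat (2 ^ (h + 1) - 2) (2 ^ (h + 1) - 2)
     (\<lambda>(r, c). A1_block h (r div 2 + 1) (c div 2 + 1) $$ (r mod 2, c mod 2))"

text \<open>The first \<open>2\<^sup>h - 2\<close> columns vanish; the remaining \<open>2\<^sup>h\<close> columns form a free diagonal
  matrix.\<close>

definition A2_mat :: "nat \<Rightarrow> sentry mat" where
  "A2_mat h = mat (2 ^ h) (2 ^ (h + 1) - 2)
     (\<lambda>(r, c). if c = 2 ^ h - 2 + r then Free else Fixed 0)"

definition zero_pattern :: "nat \<Rightarrow> nat \<Rightarrow> sentry mat" where
  "zero_pattern nr nc = mat nr nc (\<lambda>_. Fixed 0)"

definition ext_A :: "nat \<Rightarrow> sentry mat" where
  "ext_A h = four_block_mat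
     (A1_mat h) (zero_pattern (2 ^ (h + 1) - 2) (2 ^ h))
     (A2_mat h) (zero_pattern (2 ^ h) (2 ^ h))"

definition ext_dim :: "nat \<Rightarrow> nat" where
  "ext_dim h = 2 * (2 ^ h - 1) + 2 ^ h"

definition ext_B :: "nat \<Rightarrow> sentry mat" where
  "ext_B h = mat (ext_dim h) 1 (\<lambda>(r, _). if r < 2 then Free else Fixed 0)"

text \<open>\<open>diag(c\<^sub>1, \<dots>, c\<^sub>n)\<close>: the \<open>1 \<times> 2\<close> free blocks of the non-leaf subsystems in the upper
  left corner, the \<open>1 \<times> 1\<close> blocks \<open>1\<close> of the leaves in the lower right one.\<close>

definition ext_C :: "nat \<Rightarrow> sentry mat" where
  "ext_C h = four_block_mat
     (mat (2 ^ h - 1) (2 * (2 ^ h - 1)) (\<lambda>(r, c). if c div 2 = r then Free else Fixed 0))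
     (zero_pattern (2 ^ h - 1) (2 ^ h))
     (zero_pattern (2 ^ h) (2 * (2 ^ h - 1)))
     (mat (2 ^ h) (2 ^ h) (\<lambda>(r, c). if r = c then Fixed 1 else Fixed 0))"

lemma ext_A_carrier: "ext_A h \<in> carrier_mat (ext_dim h) (ext_dim h)"
  and ext_B_carrier: "ext_B h \<in> carrier_mat (ext_dim h) 1"
  and ext_C_carrier: "ext_C h \<in> carrier_mat (2 ^ (h + 1) - 1) (ext_dim h)"
proof -
  have "(1::nat) \<le> 2 ^ h" by simp
  then have "2 ^ h - 1 + 2 ^ h = 2 * 2 ^ h - (1::nat)" by linarith
  then show "ext_C h \<in> carrier_mat (2 ^ (h + 1) - 1) (ext_dim h)"
    by (intro carrier_matI) (simp_all add: ext_C_def zero_pattern_def ext_dim_def)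
qed (auto simp: ext_A_def ext_B_def A1_mat_def A2_mat_def zero_pattern_def ext_dim_def
    diff_mult_distrib2 intro!: carrier_matI)

end

theory Submission
  imports
    Defs
    "HOL-Computational_Algebra.Polynomial_FPS"
    "HOL-Computational_Algebra.Polynomial_Factorial"
    "HOL-Computational_Algebra.Field_as_Ring"
begin

text \<open>Realize the internal dynamics of subsystem \<open>i\<close> by the Jordan block with rows \<open>(i, 0)\<close>
  and \<open>(1, i)\<close>, all links by \<open>1\<close>, and let every output be the first state of its subsystem. In
  terms of generating functions in \<open>z\<close>, node \<open>i\<close> multiplies its input by \<open>1 / (1 - i z)\<close>
  and by \<open>z / (1 - i z)\<^sup>2\<close>, and \<open>z\<close> times these is passed on to the left and the right
  child. A linear combination of the outputs of a subtree with \<open>n\<close> nodes is therefore its input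
  times \<open>N / D\<close>, where \<open>deg N \<le> deg D = n - 1\<close> and \<open>D\<close> is the product of \<open>(1 - j z)\<^sup>2\<close>
  over its inner nodes \<open>j\<close>. If the combination vanishes on the first \<open>n\<close> columns of the output
  controllability matrix, then \<open>N = 0\<close>. The denominators of the left and the right subtree
  are coprime, so \<open>N = 0\<close> forces \<open>D\<^sub>L\<close> to divide \<open>N\<^sub>L\<close> and \<open>D\<^sub>R\<close> to divide \<open>N\<^sub>R\<close>. By
  the degree bounds both quotients are constants \<open>\<phi>\<close> and \<open>\<psi>\<close>, and
  \<open>z (1 - i z) \<phi> + z\<^sup>2 \<psi> + v\<^sub>i (1 - i z) = 0\<close> makes \<open>\<phi>\<close>, \<open>\<psi>\<close> and the coefficient
  \<open>v\<^sub>i\<close> of the root of the subtree vanish; recursion on the subtrees finishes the proof.\<close>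

section \<open>Full row rank from a trivial left kernel\<close>

text \<open>Testing the first \<open>n\<close> columns suffices: they form a square block
  \<open>W\<close>, and the trivial left kernel makes its determinant nonzero, so \<open>M\<close>
  has \<open>n\<close> independent columns.\<close>

lemma full_row_rankI:
  fixes M :: "real mat"
  assumes M: "M \<in> carrier_mat n nc" and "n \<le> nc"
    and ker: "\<And>w. (\<And>k. k < n \<Longrightarrow> (\<Sum>i<n. w i * M $$ (i, k)) = 0) \<Longrightarrow> \<forall>i<n. w i = 0"
  shows "full_row_rank M"
proof -
  interpret vec_space "TYPE(real)" n .
  define W where "W = mat n n (\<lambda>ik. M $$ ik)"
  have W: "W \<in> carrier_mat n n" by (simp add: W_def)
  have "det (transpose_mat W) \<noteq> 0"
  proof
    assume "det (transpose_mat W) = 0"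
    then obtain w where w: "w \<in> carrier_vec n" "w \<noteq> 0\<^sub>v n" "transpose_mat W *\<^sub>v w = 0\<^sub>v n"
      using det_0_iff_vec_prod_zero_field[of "transpose_mat W" n] W by auto
    have "(\<Sum>i<n. w $ i * M $$ (i, k)) = 0" if "k < n" for k
    proof -
      have "(transpose_mat W *\<^sub>v w) $ k = (\<Sum>i<n. w $ i * M $$ (i, k))"
        using that w(1) by (auto simp: W_def scalar_prod_def lessThan_atLeast0 intro!: sum.cong)
      then show ?thesis using that w(3) by simp
    qed
    then have "\<forall>i<n. w $ i = 0" by (rule ker)
    then show False using w(1,2) by (auto intro!: eq_vecI)
  qed
  then have det: "det W \<noteq> 0" using det_transpose[OF W] by simp
  then have rank: "rank W = n" using det_rank_iff[OF W] by simp
  have dist: "distinct (cols W)" using non_distinct_low_rank[OF W] rank by auto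
  have indpt: "lin_indpt (set (cols W))" by (rule full_rank_lin_indpt[OF W rank dist])
  have "set (cols W) \<subseteq> set (cols M)"
  proof
    fix c assume "c \<in> set (cols W)"
    then obtain k where k: "k < n" "c = col W k" using W by (auto simp: cols_def)
    have "c = col M k" unfolding k(2) by (rule eq_vecI) (use k M \<open>n \<le> nc\<close> in \<open>auto simp: W_def\<close>)
    then show "c \<in> set (cols M)" using k(1) M \<open>n \<le> nc\<close> by (auto simp: cols_def)
  qed
  from rank_ge_card_indpt[OF M this indpt] have "n \<le> rank M"
    using dist W by (simp add: distinct_card)
  moreover have "rank M \<le> n"
  proof -
    obtain S where S: "maximal S (\<lambda>T. T \<subseteq> set (cols M) \<and> lin_indpt T)" "finite S"
      using maximal_exists_superset[of "set (cols M)" "\<lambda>T. T \<subseteq> set (cols M) \<and> lin_indpt T" "{}"]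
      by (meson List.finite_set empty_subsetI fin_dim_li_fin finite_basis_exists fin_dim
          subset_li_is_li basis_def)
    then have "S \<subseteq> carrier_vec n" "lin_indpt S"
      using M cols_dim[of M] by (auto simp: maximal_def)
    then show ?thesis using rank_card_indpt[OF M S(1)] li_le_dim(2)[OF fin_dim, of S] dim_is_n by simp
  qed
  ultimately show ?thesis using M by (simp add: full_row_rank_def)
qed

section \<open>Subtrees\<close>

text \<open>In the level-by-level labelling the parent of \<open>m\<close> is
  \<open>m div 2\<close>, so \<open>m div 2 ^ d\<close> is the ancestor \<open>d\<close> levels
  up.\<close>

definition subtree :: "nat \<Rightarrow> nat \<Rightarrow> nat set" where
  "subtree i k = {m. \<exists>d\<le>k. m div 2 ^ d = i}"

lemma subtree_0: "subtree i 0 = {i}"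
  by (auto simp: subtree_def)

lemma subtree_Suc: "subtree i (Suc k) = insert i (subtree (2 * i) k \<union> subtree (2 * i + 1) k)"
proof -
  have *: "m div 2 ^ Suc d = i \<longleftrightarrow> m div 2 ^ d = 2 * i \<or> m div 2 ^ d = 2 * i + 1" for m d
    unfolding power_Suc2 div_mult2_eq by linarith
  have "(\<exists>d\<le>Suc k. m div 2 ^ d = i) \<longleftrightarrow> m div 2 ^ 0 = i \<or> (\<exists>d\<le>k. m div 2 ^ Suc d = i)" for m
    by (metis Suc_le_mono le0 not0_implies_Suc)
  then show ?thesis unfolding subtree_def * by auto
qed

lemma subtree_ge: "m \<in> subtree i k \<Longrightarrow> i \<le> m"
  by (auto simp: subtree_def)

lemma finite_subtree: "finite (subtree i k)"
  by (induction k arbitrary: i) (simp_all add: subtree_0 subtree_Suc)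

text \<open>Ancestors of one label on different levels differ by a factor of at least two, which
  \<open>2 * i\<close> and \<open>2 * i + 1\<close> do not for positive \<open>i\<close>; on the
  same level they coincide.\<close>

lemma subtree_disjoint:
  assumes "1 \<le> i"
  shows "subtree (2 * i) k \<inter> subtree (2 * i + 1) k = {}"
proof -
  have less: "m div 2 ^ e \<le> (m div 2 ^ d) div 2" if "d < e" for m d e :: nat
  proof -
    from that obtain f where "e = d + Suc f" using less_iff_Suc_add by auto
    then have "m div 2 ^ e = m div 2 ^ d div 2 div 2 ^ f"
      by (simp only: power_add power_Suc div_mult2_eq)
    then show ?thesis by simp
  qed
  have False if "m div 2 ^ d = 2 * i" "m div 2 ^ e = 2 * i + 1" for m d e
    using less[of d e m] less[of e d m] that assms by (cases d e rule: linorder_cases) auto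
  then show ?thesis by (auto simp: subtree_def)
qed

lemma subtree_1: "subtree 1 k = {1..<2 ^ (k + 1)}"
proof (intro equalityI subsetI)
  fix m assume "m \<in> subtree 1 k"
  then obtain d where d: "d \<le> k" "m div 2 ^ d = 1" by (auto simp: subtree_def)
  then have "m < 2 ^ (d + 1)" using div_less_iff_less_mult[of "2 ^ d" m 2] by simp
  also have "\<dots> \<le> 2 ^ (k + 1)" using d by (intro power_increasing) auto
  finally show "m \<in> {1..<2 ^ (k + 1)}" using d(2) by (cases m) auto
next
  fix m :: nat assume m: "m \<in> {1..<2 ^ (k + 1)}"
  then obtain d where d: "2 ^ d \<le> m" "m < 2 ^ (d + 1)" using ex_power_ivl1[of 2 m] by auto
  have "(2::nat) ^ d < 2 ^ (k + 1)" using d m by simp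
  then have "d \<le> k" by (subst (asm) power_strict_increasing_iff) auto
  moreover have "m div 2 ^ d = 1"
    using d by (intro div_nat_eqI) (auto simp: algebra_simps)
  ultimately show "m \<in> subtree 1 k" by (auto simp: subtree_def)
qed

section \<open>Transfer functions of subtrees\<close>

primrec subtree_denom :: "nat \<Rightarrow> nat \<Rightarrow> real poly" where
  "subtree_denom i 0 = 1"
| "subtree_denom i (Suc k) =
     [:1, - real i:] ^ 2 * subtree_denom (2 * i) k * subtree_denom (2 * i + 1) k"

text \<open>The summands stem from the left subtree, the right subtree and node \<open>i\<close>
  itself. They are reached from the input of \<open>i\<close> by the factors
  \<open>z / (1 - i z)\<close>, \<open>z ^ 2 / (1 - i z) ^ 2\<close> and
  \<open>1 / (1 - i z)\<close>, here brought to the common denominator.\<close>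

primrec subtree_numer :: "(nat \<Rightarrow> real) \<Rightarrow> nat \<Rightarrow> nat \<Rightarrow> real poly" where
  "subtree_numer v i 0 = [:v i:]"
| "subtree_numer v i (Suc k) =
     [:0, 1:] * [:1, - real i:] * subtree_denom (2 * i + 1) k * subtree_numer v (2 * i) k
   + [:0, 1:] ^ 2 * subtree_denom (2 * i) k * subtree_numer v (2 * i + 1) k
   + smult (v i) ([:1, - real i:] * subtree_denom (2 * i) k * subtree_denom (2 * i + 1) k)"

text \<open>The last two hypotheses place the deepest level of the subtree, the labels from
  \<open>i * 2 ^ k\<close> to \<open>(i + 1) * 2 ^ k - 1\<close>, among the leaves. All equations
  are cleared of denominators, so the induction never divides power series.\<close>

lemma subtree_transfer:
  fixes first second inp :: "nat \<Rightarrow> real fps"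
  assumes first: "\<And>i. 1 \<le> i \<Longrightarrow> i < 2 ^ h \<Longrightarrow> first i * fps_of_poly [:1, - real i:] = inp i"
    and second: "\<And>i. 1 \<le> i \<Longrightarrow> i < 2 ^ h \<Longrightarrow>
      second i * fps_of_poly [:1, - real i:] = fps_X * first i"
    and left: "\<And>i. 1 \<le> i \<Longrightarrow> i < 2 ^ h \<Longrightarrow> inp (2 * i) = fps_X * first i"
    and right: "\<And>i. 1 \<le> i \<Longrightarrow> i < 2 ^ h \<Longrightarrow> inp (2 * i + 1) = fps_X * second i"
    and leaf: "\<And>i. 2 ^ h \<le> i \<Longrightarrow> i < 2 ^ (h + 1) \<Longrightarrow> first i = inp i"
    and "1 \<le> i" "2 ^ h \<le> i * 2 ^ k" "(i + 1) * 2 ^ k \<le> 2 ^ (h + 1)"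
  shows "(\<Sum>m\<in>subtree i k. fps_const (v m) * first m) * fps_of_poly (subtree_denom i k)
    = fps_of_poly (subtree_numer v i k) * inp i"
  using assms(6-8)
proof (induction k arbitrary: i)
  case 0
  then show ?case using leaf[of i] by (simp add: subtree_0 fps_of_poly_const)
next
  case (Suc k)
  define a where "a = fps_of_poly [:1, - real i:]"
  define DL DR where "DL = fps_of_poly (subtree_denom (2 * i) k)"
    and "DR = fps_of_poly (subtree_denom (2 * i + 1) k)"
  define NL NR where "NL = fps_of_poly (subtree_numer v (2 * i) k)"
    and "NR = fps_of_poly (subtree_numer v (2 * i + 1) k)"
  define SL SR where "SL = (\<Sum>m\<in>subtree (2 * i) k. fps_const (v m) * first m)"
    and "SR = (\<Sum>m\<in>subtree (2 * i + 1) k. fps_const (v m) * first m)"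
  have "(i + 1) * 2 ^ k \<le> 2 ^ h" using Suc.prems(3) by simp
  moreover have "(1::nat) \<le> 2 ^ k" by simp
  ultimately have "i + 1 \<le> 2 ^ h" by (metis le_trans mult_le_mono2 mult.right_neutral)
  then have i: "1 \<le> i" "i < 2 ^ h" using Suc.prems(1) by auto
  have L: "SL * DL = NL * (fps_X * first i)"
    unfolding SL_def DL_def NL_def left[OF i, symmetric]
    by (rule Suc.IH) (use Suc.prems in \<open>auto simp: algebra_simps\<close>)
  have R: "SR * DR = NR * (fps_X * second i)"
    unfolding SR_def DR_def NR_def right[OF i, symmetric]
    by (rule Suc.IH) (use Suc.prems in \<open>auto simp: algebra_simps\<close>)
  have f: "first i * a = inp i" and s: "second i * a = fps_X * first i"
    unfolding a_def using first[OF i] second[OF i] by auto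
  have "i \<notin> subtree (2 * i) k \<union> subtree (2 * i + 1) k"
    using subtree_ge[of i] i(1) by fastforce
  then have "(\<Sum>m\<in>subtree i (Suc k). fps_const (v m) * first m) = fps_const (v i) * first i
      + (\<Sum>m\<in>subtree (2 * i) k \<union> subtree (2 * i + 1) k. fps_const (v m) * first m)"
    unfolding subtree_Suc using finite_subtree by (intro sum.insert) auto
  then have S: "(\<Sum>m\<in>subtree i (Suc k). fps_const (v m) * first m)
      = fps_const (v i) * first i + SL + SR"
    unfolding SL_def SR_def
    by (simp only: sum.union_disjoint[OF finite_subtree finite_subtree subtree_disjoint[OF i(1)]] add.assoc)
  have D: "fps_of_poly (subtree_denom i (Suc k)) = a ^ 2 * DL * DR"
    by (simp add: a_def DL_def DR_def fps_of_poly_mult fps_of_poly_power del: fps_of_poly_pCons)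
  have X: "fps_of_poly [:0, 1:] = (fps_X :: real fps)"
    by (simp add: fps_of_poly_pCons)
  have N: "fps_of_poly (subtree_numer v i (Suc k)) =
      fps_X * a * DR * NL + fps_X ^ 2 * DL * NR + fps_const (v i) * (a * DL * DR)"
    unfolding subtree_numer.simps a_def DL_def DR_def NL_def NR_def
    by (simp only: fps_of_poly_mult fps_of_poly_power fps_of_poly_add fps_of_poly_smult X)
  \<comment> \<open>Each subtree sum is traded for its numerator; then factors \<open>a\<close> are
    spent on turning \<open>second i\<close> into \<open>first i\<close> and \<open>first i\<close>
    into \<open>inp i\<close>.\<close>
  have "(fps_const (v i) * first i + SL + SR) * (a ^ 2 * DL * DR) =
      fps_const (v i) * (first i * a) * a * DL * DR + (SL * DL) * a ^ 2 * DR + (SR * DR) * a ^ 2 * DL"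
    by (simp add: algebra_simps power2_eq_square)
  also have "\<dots> = fps_const (v i) * (first i * a) * a * DL * DR
      + NL * fps_X * (first i * a) * a * DR + NR * fps_X * (second i * a) * a * DL"
    unfolding L R by (simp add: algebra_simps power2_eq_square)
  also have "\<dots> = fps_const (v i) * (first i * a) * a * DL * DR
      + NL * fps_X * (first i * a) * a * DR + NR * fps_X ^ 2 * (first i * a) * DL"
    unfolding s by (simp add: algebra_simps power2_eq_square)
  also have "\<dots> = (fps_X * a * DR * NL + fps_X ^ 2 * DL * NR + fps_const (v i) * (a * DL * DR)) * inp i"
    unfolding f by (simp add: algebra_simps)
  finally show ?case unfolding S D N .
qed

section \<open>Degrees of numerators and denominators\<close>

lemma subtree_denom_nz: "subtree_denom i k \<noteq> 0"
  by (induction k arbitrary: i) auto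

text \<open>Each of the \<open>2 ^ k - 1\<close> inner nodes contributes two; adding
  \<open>2\<close> on the left avoids truncated subtraction.\<close>

lemma degree_subtree_denom:
  assumes "1 \<le> i"
  shows "degree (subtree_denom i k) + 2 = 2 ^ (k + 1)"
  using assms
proof (induction k arbitrary: i)
  case (Suc k)
  have "degree (subtree_denom (2 * i) k) + 2 = 2 ^ (k + 1)"
    "degree (subtree_denom (2 * i + 1) k) + 2 = 2 ^ (k + 1)"
    using Suc.prems by (intro Suc.IH; simp)+
  moreover have "degree ([:1, - real i:] ^ 2) = 2"
    using Suc.prems by (subst degree_power_eq) auto
  ultimately show ?case
    using subtree_denom_nz by (simp add: degree_mult_eq)
qed simp

text \<open>No summand of the numerator exceeds the degree of the denominator. This makes the later
  quotients constant, and for the whole tree it leaves only as many coefficients as there are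
  subsystems.\<close>

lemma degree_subtree_numer:
  assumes "1 \<le> i"
  shows "degree (subtree_numer v i k) + 2 \<le> 2 ^ (k + 1)"
  using assms
proof (induction k arbitrary: i)
  case (Suc k)
  define a z where "a = [:1, - real i:]" and "z = [:0, 1 :: real:]"
  define DL DR where "DL = subtree_denom (2 * i) k" and "DR = subtree_denom (2 * i + 1) k"
  define NL NR where "NL = subtree_numer v (2 * i) k" and "NR = subtree_numer v (2 * i + 1) k"
  have "degree DL + 2 = 2 ^ (k + 1)" "degree DR + 2 = 2 ^ (k + 1)"
    unfolding DL_def DR_def using Suc.prems by (intro degree_subtree_denom; simp)+
  moreover have "degree NL + 2 \<le> 2 ^ (k + 1)" "degree NR + 2 \<le> 2 ^ (k + 1)"
    unfolding NL_def NR_def using Suc.prems by (intro Suc.IH; simp)+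
  moreover have "degree a \<le> 1" "degree z \<le> 1" by (auto simp: a_def z_def)
  moreover have "degree (z * a * DR * NL) \<le> degree z + degree a + degree DR + degree NL"
    by (meson add_mono degree_mult_le order.refl order_trans)
  moreover have "degree (z ^ 2 * DL * NR) \<le> degree z + degree z + degree DL + degree NR"
    unfolding power2_eq_square by (meson add_mono degree_mult_le order.refl order_trans)
  moreover have "degree (smult (v i) (a * DL * DR)) \<le> degree a + degree DL + degree DR"
    by (meson add_mono degree_mult_le degree_smult_le order.refl order_trans)
  moreover have "subtree_numer v i (Suc k)
      = z * a * DR * NL + z ^ 2 * DL * NR + smult (v i) (a * DL * DR)"
    by (simp add: a_def z_def DL_def DR_def NL_def NR_def)
  ultimately have "degree (subtree_numer v i (Suc k)) \<le> 2 ^ (Suc k + 1) - 2"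
    by (auto intro!: degree_add_le)
  moreover have "(2::nat) \<le> 2 ^ (Suc k + 1)" by simp
  ultimately show ?case by linarith
qed simp

section \<open>Coprimality and vanishing numerators\<close>

lemma coprime_linear_poly:
  fixes p :: "real poly"
  assumes "m \<noteq> 0" "poly p (1 / m) \<noteq> 0"
  shows "coprime [:1, - m:] p"
proof (rule coprimeI)
  fix d assume d: "d dvd [:1, - m:]" "d dvd p"
  \<comment> \<open>Division of \<open>p\<close> by the monic multiple leaves the remainder
    \<open>poly p (1 / m)\<close>, a nonzero constant that every common divisor must divide.\<close>
  have "[:1, - m:] = smult (- m) [:- (1 / m), 1:]" using assms(1) by simp
  then have "d dvd [:- (1 / m), 1:]" using d(1) assms(1) by (metis dvd_smult_cancel neg_equal_0_iff_equal)
  then have "d dvd [:- (1 / m), 1:] * synthetic_div p (1 / m)" by (rule dvd_mult2)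
  moreover have "d dvd [:- (1 / m), 1:] * synthetic_div p (1 / m) + [:poly p (1 / m):]"
    using d(2) synthetic_div_correct'[of "1 / m" p] by metis
  ultimately have "d dvd [:poly p (1 / m):]" using dvd_add_right_iff by blast
  then show "is_unit d" using assms(2) by (metis dvd_trans is_unit_const_poly_iff dvd_field_iff)
qed

lemma coprime_subtree_denom:
  assumes "1 \<le> i" "\<And>m. m \<in> subtree i k \<Longrightarrow> poly p (1 / real m) \<noteq> 0"
  shows "coprime (subtree_denom i k) p"
  using assms
proof (induction k arbitrary: i)
  case (Suc k)
  have "coprime (subtree_denom (2 * i) k) p" "coprime (subtree_denom (2 * i + 1) k) p"
    using Suc.prems by (intro Suc.IH; simp add: subtree_Suc)+
  moreover have "coprime [:1, - real i:] p"
    using Suc.prems by (intro coprime_linear_poly) (auto simp: subtree_Suc)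
  ultimately show ?case by simp
qed simp

text \<open>With the disjointness of sibling subtrees this shows that their denominators share no
  root, as required by \<open>coprime_subtree_denom\<close>.\<close>

lemma subtree_denom_root:
  assumes "1 \<le> i" "1 \<le> m" "poly (subtree_denom i k) (1 / real m) = 0"
  shows "m \<in> subtree i k"
  using assms
proof (induction k arbitrary: i)
  case (Suc k)
  have "poly [:1, - real i:] (1 / real m) = 0 \<longrightarrow> m = i"
    using Suc.prems by (simp add: field_simps)
  then show ?case
    using Suc.prems Suc.IH[of "2 * i"] Suc.IH[of "2 * i + 1"] by (auto simp: subtree_Suc)
qed simp

lemma dvd_imp_smult:
  fixes p q :: "real poly"
  assumes "q dvd p" "degree p \<le> degree q"
  obtains c where "p = smult c q"
proof (cases "p = 0")
  case False
  from assms(1) obtain r where r: "p = q * r" by auto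
  then have "degree r = 0" using assms(2) False by (auto simp: degree_mult_eq)
  then obtain c where "r = [:c:]" by (rule degree_eq_zeroE)
  then show ?thesis using r that by simp
qed (use that[of 0] in simp)

lemma subtree_numer_eq_0:
  assumes "1 \<le> i" "subtree_numer v i k = 0" "m \<in> subtree i k"
  shows "v m = 0"
  using assms
proof (induction k arbitrary: i)
  case 0
  then show ?case by (simp add: subtree_0)
next
  case (Suc k)
  define a where "a = [:1, - real i:]"
  define z where "z = [:0, 1 :: real:]"
  define DL DR where "DL = subtree_denom (2 * i) k" and "DR = subtree_denom (2 * i + 1) k"
  define NL NR where "NL = subtree_numer v (2 * i) k" and "NR = subtree_numer v (2 * i + 1) k"
  have i: "1 \<le> 2 * i" "1 \<le> 2 * i + 1" using Suc.prems(1) by auto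
  have nz: "DL \<noteq> 0" "DR \<noteq> 0" by (simp_all add: DL_def DR_def subtree_denom_nz)
  have eq: "z * a * DR * NL + z ^ 2 * DL * NR + smult (v i) (a * DL * DR) = 0"
    using Suc.prems(2) by (simp add: a_def z_def DL_def DR_def NL_def NR_def)
  have disj: "subtree (2 * i) k \<inter> subtree (2 * i + 1) k = {}"
    by (rule subtree_disjoint[OF Suc.prems(1)])
  \<comment> \<open>The factors \<open>z\<close> and \<open>a\<close> vanish only at
    \<open>0\<close> and \<open>1 / i\<close>, while the labels in a child's subtree exceed
    \<open>i\<close>; the roots of \<open>DR\<close> belong to the other subtree.\<close>
  have copL: "coprime DL (z * a * DR)" unfolding DL_def
  proof (rule coprime_subtree_denom[OF i(1)])
    fix m assume m: "m \<in> subtree (2 * i) k"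
    then have "i < m" using subtree_ge[OF m] Suc.prems(1) by simp
    moreover have "poly DR (1 / real m) \<noteq> 0"
      using subtree_denom_root[OF i(2), of m k] \<open>i < m\<close> m disj by (auto simp: DR_def)
    ultimately show "poly (z * a * DR) (1 / real m) \<noteq> 0"
      by (simp add: z_def a_def field_simps)
  qed
  have copR: "coprime DR (z ^ 2 * DL)" unfolding DR_def
  proof (rule coprime_subtree_denom[OF i(2)])
    fix m assume m: "m \<in> subtree (2 * i + 1) k"
    then have "i < m" using subtree_ge[OF m] by simp
    moreover have "poly DL (1 / real m) \<noteq> 0"
      using subtree_denom_root[OF i(1), of m k] \<open>i < m\<close> m disj by (auto simp: DL_def)
    ultimately show "poly (z ^ 2 * DL) (1 / real m) \<noteq> 0"
      by (simp add: z_def field_simps)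
  qed
  \<comment> \<open>The other two summands of \<open>eq\<close> contain \<open>DL\<close>;
    coprimality then passes the divisibility on to \<open>NL\<close>.\<close>
  have "z * a * DR * NL = DL * (- (z ^ 2 * NR) - smult (v i) (a * DR))"
    using eq by (simp add: algebra_simps eq_neg_iff_add_eq_0)
  then have "DL dvd z * a * DR * NL" by simp
  then have "DL dvd NL" using copL by (simp add: coprime_dvd_mult_right_iff)
  moreover have "degree NL \<le> degree DL"
    using degree_subtree_numer[OF i(1), of v k] degree_subtree_denom[OF i(1), of k]
    by (simp add: NL_def DL_def)
  ultimately obtain \<phi> where \<phi>: "NL = smult \<phi> DL" by (rule dvd_imp_smult)
  have "z ^ 2 * DL * NR = DR * (- (z * a * NL) - smult (v i) (a * DL))"
    using eq by (simp add: algebra_simps eq_neg_iff_add_eq_0)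
  then have "DR dvd z ^ 2 * DL * NR" by simp
  then have "DR dvd NR" using copR by (simp add: coprime_dvd_mult_right_iff)
  moreover have "degree NR \<le> degree DR"
    using degree_subtree_numer[OF i(2), of v k] degree_subtree_denom[OF i(2), of k]
    by (simp add: NR_def DR_def)
  ultimately obtain \<psi> where \<psi>: "NR = smult \<psi> DR" by (rule dvd_imp_smult)
  have "(smult \<phi> (z * a) + smult \<psi> (z ^ 2) + smult (v i) a) * (DL * DR) = 0"
    using eq unfolding \<phi> \<psi> by (simp add: algebra_simps)
  then have "smult \<phi> (z * a) + smult \<psi> (z ^ 2) + smult (v i) a = 0" using nz by simp
  \<comment> \<open>The system of coefficients is triangular: it yields \<open>v i\<close>, then
    \<open>\<phi>\<close>, then \<open>\<psi>\<close>.\<close>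
  then have "[:v i, \<phi> - v i * real i, \<psi> - \<phi> * real i:] = 0"
    by (simp add: z_def a_def power2_eq_square algebra_simps)
  then have zero: "v i = 0" "\<phi> = 0" "\<psi> = 0" by auto
  then have "NL = 0" "NR = 0" using \<phi> \<psi> by auto
  then show ?case
    using Suc.prems(3) zero(1) Suc.IH[OF i(1)] Suc.IH[OF i(2)]
    by (auto simp: subtree_Suc NL_def NR_def)
qed

section \<open>A controllable realization\<close>

definition core_dim :: "nat \<Rightarrow> nat" where
  "core_dim h = 2 ^ (h + 1) - 2"

text \<open>In the realization below every state \<open>r > 0\<close> is driven by exactly one other state,
  \<open>source h r\<close>; the value at \<open>r = 0\<close>, which is driven by the input, is junk.\<close>

definition source :: "nat \<Rightarrow> nat \<Rightarrow> nat" where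
  "source h r = (if r < core_dim h then if even r then r div 2 - 1 else r - 1 else r - 2 ^ h)"

text \<open>Labels on the diagonal give the inner nodes pairwise different eigenvalues, hence
  different poles \<open>1 / i\<close>.\<close>

definition real_A :: "nat \<Rightarrow> real mat" where
  "real_A h = mat (ext_dim h) (ext_dim h) (\<lambda>(r, c).
     (if r < core_dim h \<and> c = r then real (r div 2 + 1) else 0) +
     (if 0 < r \<and> c = source h r then 1 else 0))"

definition real_B :: "nat \<Rightarrow> real mat" where
  "real_B h = mat (ext_dim h) 1 (\<lambda>(r, _). if r = 0 then 1 else 0)"

text \<open>For a leaf and \<open>1 \<le> h\<close> the index is
  \<open>core_dim h + (i - 2 ^ h)\<close>.\<close>

definition first_state :: "nat \<Rightarrow> nat \<Rightarrow> nat" where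
  "first_state h i = (if i < 2 ^ h then 2 * (i - 1) else 2 ^ h - 2 + i)"

definition real_C :: "nat \<Rightarrow> real mat" where
  "real_C h = mat (2 ^ (h + 1) - 1) (ext_dim h) (\<lambda>(r, c).
     if c = first_state h (r + 1) then 1 else 0)"

lemma ext_dim_eq: "1 \<le> h \<Longrightarrow> ext_dim h = core_dim h + 2 ^ h"
  by (simp add: ext_dim_def core_dim_def diff_mult_distrib2)

lemma core_dim_ge: "1 \<le> h \<Longrightarrow> 2 ^ h \<le> core_dim h"
proof -
  assume "1 \<le> h"
  then have "(2::nat) ^ 1 \<le> 2 ^ h" by (intro power_increasing) auto
  then show ?thesis by (simp add: core_dim_def)
qed

text \<open>One formula covers both links: child \<open>2 * j + b\<close> is driven, in its first
  state, by state \<open>b\<close> of its parent.\<close>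

lemma A1_block_index:
  assumes j: "j \<in> {1..2 ^ h - 1}" and "a < 2" "b < 2"
  shows "A1_block h i j $$ (a, b) =
    (if i = j \<or> a = 0 \<and> i = 2 * j + b then Free else Fixed 0)"
proof -
  have "a = 0 \<or> a = 1" "b = 0 \<or> b = 1" using assms by auto
  then show ?thesis
    unfolding A1_block_def Min_children[OF j] Max_children[OF j]
    by (elim disjE) (simp_all add: mat_of_rows_list_def)
qed

lemma real_A_realization:
  assumes "1 \<le> h"
  shows "real_A h \<in> realizations (ext_A h)"
proof -
  have p: "(2::nat) \<le> 2 ^ h" using power_increasing[of 1 h "2::nat"] assms by simp
  have "real_A h $$ (r, c) = q"
    if rc: "r < ext_dim h" "c < ext_dim h" and q: "ext_A h $$ (r, c) = Fixed q" for r c q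
  proof (cases "r < core_dim h")
    case r: True
    show ?thesis
    proof (cases "c < core_dim h")
      case c: True
      have j: "c div 2 + 1 \<in> {1..2 ^ h - 1}" using c p by (auto simp: core_dim_def)
      have "ext_A h $$ (r, c) = A1_block h (r div 2 + 1) (c div 2 + 1) $$ (r mod 2, c mod 2)"
        using r c rc by (simp add: ext_A_def A1_mat_def A2_mat_def zero_pattern_def core_dim_def)
      \<comment> \<open>Since \<open>2 * (c div 2) + c mod 2 = c\<close>, the child condition
        \<open>i = 2 * j + b\<close> becomes \<open>r div 2 + 1 = c + 2\<close>.\<close>
      then have "r div 2 \<noteq> c div 2 \<and> \<not> (r mod 2 = 0 \<and> r div 2 = c + 2 - 1) \<and> q = 0"
        using q A1_block_index[OF j, of "r mod 2" "c mod 2" "r div 2 + 1"]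
        by (auto split: if_splits)
      moreover from this have "c \<noteq> r" "\<not> (0 < r \<and> c = source h r)"
        using r by (auto simp: source_def elim!: oddE)
      ultimately show ?thesis using rc by (simp add: real_A_def)
    next
      case c: False
      then have "ext_A h $$ (r, c) = Fixed 0"
        using r rc assms
        by (simp add: ext_A_def A1_mat_def A2_mat_def zero_pattern_def core_dim_def ext_dim_eq)
      moreover have "c \<noteq> r" "c \<noteq> source h r" using r c by (auto simp: source_def)
      ultimately show ?thesis using rc q by (simp add: real_A_def)
    qed
  next
    case r: False
    \<comment> \<open>The free diagonal for the leaves starts in column \<open>2 ^ h - 2\<close>, so
      the free entry of each leaf row sits at its source.\<close>
    have s: "2 ^ h - 2 + (r - core_dim h) = source h r"
      using r p by (simp add: source_def core_dim_def)
    have "source h r < core_dim h"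
      using r rc core_dim_ge[OF assms] by (simp add: source_def ext_dim_eq[OF assms])
    then have "ext_A h $$ (r, c) = (if c = 2 ^ h - 2 + (r - core_dim h) then Free else Fixed 0)"
      unfolding s using r rc s
      by (simp add: ext_A_def A1_mat_def A2_mat_def zero_pattern_def ext_dim_eq[OF assms])
         (auto simp: core_dim_def)
    then have "c \<noteq> source h r" "q = 0" using q s by (auto split: if_splits)
    then show ?thesis using rc r by (simp add: real_A_def)
  qed
  then show ?thesis
    using ext_A_carrier[of h] by (auto simp: realizations_def real_A_def[of h])
qed

lemma real_B_realization: "real_B h \<in> realizations (ext_B h)"
  by (auto simp: realizations_def real_B_def ext_B_def)

lemma real_C_realization:
  assumes "1 \<le> h"
  shows "real_C h \<in> realizations (ext_C h)"
proof -
  have p: "(2::nat) \<le> 2 ^ h" using power_increasing[of 1 h "2::nat"] assms by simp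
  have "real_C h $$ (r, c) = q"
    if rc: "r < 2 ^ (h + 1) - 1" "c < ext_dim h" and q: "ext_C h $$ (r, c) = Fixed q" for r c q
    using rc q p
    by (auto simp: ext_C_def zero_pattern_def real_C_def first_state_def ext_dim_def split: if_splits)
  then show ?thesis
    using ext_C_carrier[of h] by (auto simp: realizations_def real_C_def[of h])
qed

section \<open>Impulse responses as power series\<close>

definition impulse :: "nat \<Rightarrow> nat \<Rightarrow> nat \<Rightarrow> real" where
  "impulse h r k = (real_A h ^\<^sub>m k * real_B h) $$ (r, 0)"

lemma source_less:
  assumes "1 \<le> h" "r < ext_dim h"
  shows "source h r < ext_dim h"
  using assms by (auto simp: source_def ext_dim_eq)

lemma impulse_0: "r < ext_dim h \<Longrightarrow> impulse h r 0 = (if r = 0 then 1 else 0)"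
  by (simp add: impulse_def real_A_def real_B_def)

lemma pow_mat_Suc_left:
  assumes "A \<in> carrier_mat n n"
  shows "A ^\<^sub>m Suc k = A * A ^\<^sub>m k"
proof (induction k)
  case (Suc k)
  have "A ^\<^sub>m Suc (Suc k) = A * A ^\<^sub>m k * A" using Suc by simp
  also have "\<dots> = A * (A ^\<^sub>m k * A)" using assms by (intro assoc_mult_mat) auto
  finally show ?case by simp
qed (use assms in simp)

lemma impulse_Suc:
  assumes "1 \<le> h" "r < ext_dim h"
  shows "impulse h r (Suc k) = (if r < core_dim h then real (r div 2 + 1) * impulse h r k else 0)
    + (if 0 < r then impulse h (source h r) k else 0)"
proof -
  have A: "real_A h \<in> carrier_mat (ext_dim h) (ext_dim h)"
    and B: "real_B h \<in> carrier_mat (ext_dim h) 1"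
    by (simp_all add: real_A_def real_B_def)
  have "real_A h ^\<^sub>m Suc k * real_B h = real_A h * (real_A h ^\<^sub>m k * real_B h)"
    unfolding pow_mat_Suc_left[OF A] using A B by (intro assoc_mult_mat) auto
  then have "impulse h r (Suc k) = (\<Sum>c<ext_dim h. real_A h $$ (r, c) * impulse h c k)"
    using A B assms by (simp add: impulse_def scalar_prod_def lessThan_atLeast0)
  also have "\<dots> = (\<Sum>c<ext_dim h. (if c = r then if r < core_dim h then real (r div 2 + 1) * impulse h c k else 0 else 0)
      + (if c = source h r then if 0 < r then impulse h c k else 0 else 0))"
    using assms by (intro sum.cong refl) (auto simp: real_A_def algebra_simps)
  also have "\<dots> = (if r < core_dim h then real (r div 2 + 1) * impulse h r k else 0)
    + (if 0 < r then impulse h (source h r) k else 0)"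
    using assms source_less[OF assms] by (simp add: sum.distrib)
  finally show ?thesis .
qed

text \<open>This is the recursion \<open>impulse_Suc\<close> for generating functions; the
  \<open>1\<close> is the series of the impulse entering at state \<open>0\<close>.\<close>

lemma impulse_fps:
  assumes "1 \<le> h" "r < ext_dim h"
  shows "Abs_fps (impulse h r) * fps_of_poly [:1, - (if r < core_dim h then real (r div 2 + 1) else 0):]
    = (if r = 0 then 1 else fps_X * Abs_fps (impulse h (source h r)))"
proof (rule fps_ext)
  fix k
  have X: "fps_of_poly [:1, - c:] = 1 - fps_const c * fps_X" for c :: real
    by (simp add: fps_of_poly_pCons fps_const_neg[symmetric] mult.commute del: fps_const_neg)
  show "fps_nth (Abs_fps (impulse h r) *
      fps_of_poly [:1, - (if r < core_dim h then real (r div 2 + 1) else 0):]) k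
    = fps_nth (if r = 0 then 1 else fps_X * Abs_fps (impulse h (source h r))) k"
    unfolding X using assms
    by (cases k) (auto simp: right_diff_distrib mult.assoc[symmetric] mult.commute[of _ "fps_const _"]
        impulse_0 impulse_Suc)
qed

lemma output_mat_index:
  assumes "1 \<le> h" "r < 2 ^ (h + 1) - 1" "k < ext_dim h"
  shows "(real_C h * controllability_mat (real_A h) (real_B h)) $$ (r, k)
    = impulse h (first_state h (r + 1)) k"
proof -
  have "(2::nat) \<le> 2 ^ h" using power_increasing[of 1 h "2::nat"] assms by simp
  then have "first_state h (r + 1) < ext_dim h"
    using assms by (auto simp: first_state_def ext_dim_def)
  then show ?thesis using assms
    by (simp add: real_C_def controllability_mat_def real_A_def[of h] real_B_def[of h]
        scalar_prod_def impulse_def Let_def if_distrib[of "\<lambda>x. x * _"] cong: if_cong)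
qed

theorem proposition3:
  fixes h :: nat
  assumes "h \<ge> 1"
  shows "structurally_output_controllable (ext_A h) (ext_B h) (ext_C h)"
proof -
  define n :: nat where "n = 2 ^ (h + 1) - 1"
  define K where "K = real_C h * controllability_mat (real_A h) (real_B h)"
  have p: "(2::nat) \<le> 2 ^ h" using power_increasing[of 1 h "2::nat"] assms by simp
  have n: "n \<le> ext_dim h" using p by (simp add: n_def ext_dim_def)
  have "full_row_rank K"
  proof (rule full_row_rankI[OF _ n])
    show "K \<in> carrier_mat n (ext_dim h)"
      by (auto simp: K_def n_def real_C_def controllability_mat_def real_A_def real_B_def Let_def)
    fix w :: "nat \<Rightarrow> real"
    assume w: "\<And>k. k < n \<Longrightarrow> (\<Sum>r<n. w r * K $$ (r, k)) = 0"
    define v where "v i = w (i - 1)" for i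
    define state where "state r = Abs_fps (impulse h r)" for r
    define first where "first i = state (first_state h i)" for i
    define second where "second i = state (2 * i - 1)" for i
    \<comment> \<open>State \<open>i - 2\<close> feeds node \<open>i\<close>: it is the first state
      of the parent for even \<open>i\<close> and the second for odd \<open>i > 1\<close>. The root
      receives the impulse instead.\<close>
    define inp where "inp i = (if i = 1 then 1 else fps_X * state (i - 2))" for i
    define Y where "Y = (\<Sum>m\<in>subtree 1 h. fps_const (v m) * first m)"
    have transfer: "Y * fps_of_poly (subtree_denom 1 h) = fps_of_poly (subtree_numer v 1 h) * inp 1"
      unfolding Y_def
    proof (rule subtree_transfer[where second = second and h = h])
      fix i :: nat assume i: "1 \<le> i" "i < 2 ^ h"
      then have i': "2 * i - 1 < core_dim h" "2 * i - 1 < ext_dim h"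
        using p by (auto simp: core_dim_def ext_dim_def)
      obtain j where j: "i = Suc j" using i by (cases i) auto
      have f: "first_state h (Suc j) = 2 * j" using i j by (simp add: first_state_def)
      have "source h (2 * j) = i - 2" using i' j by (simp add: source_def)
      then show "first i * fps_of_poly [:1, - real i:] = inp i"
        using impulse_fps[OF assms, of "2 * j"] i' j
        by (auto simp: first_def f state_def inp_def simp del: fps_of_poly_pCons)
      have "source h (2 * j + 1) = 2 * j" using i' j by (simp add: source_def)
      then show "second i * fps_of_poly [:1, - real i:] = fps_X * first i"
        using impulse_fps[OF assms, of "2 * j + 1"] i' j
        by (auto simp: first_def second_def f state_def simp del: fps_of_poly_pCons)
      show "inp (2 * i) = fps_X * first i"
        using i by (simp add: inp_def first_def first_state_def diff_mult_distrib2)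
      show "inp (2 * i + 1) = fps_X * second i"
        using i by (simp add: inp_def second_def)
    next
      fix i :: nat assume i: "2 ^ h \<le> i" "i < 2 ^ (h + 1)"
      have "2 ^ h - 2 + i < ext_dim h" "\<not> 2 ^ h - 2 + i < core_dim h" "0 < 2 ^ h - 2 + i"
        "2 ^ h - 2 + i - 2 ^ h = i - 2"
        using i p by (auto simp: core_dim_def ext_dim_def)
      then show "first i = inp i"
        using impulse_fps[OF assms, of "2 ^ h - 2 + i"] i p
        by (auto simp: first_def first_state_def state_def inp_def source_def)
    qed (use assms in auto)
    have Y: "fps_nth Y k = 0" if "k < n" for k
    proof -
      have "fps_nth Y k = (\<Sum>m\<in>{1..<n + 1}. v m * impulse h (first_state h m) k)"
        unfolding Y_def subtree_1 by (simp add: fps_sum_nth first_def state_def n_def)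
      also have "\<dots> = (\<Sum>r<n. v (r + 1) * impulse h (first_state h (r + 1)) k)"
        by (rule sum.reindex_bij_witness[of _ "\<lambda>r. r + 1" "\<lambda>m. m - 1"]) auto
      also have "\<dots> = (\<Sum>r<n. w r * K $$ (r, k))"
        using that n output_mat_index[OF assms]
        by (intro sum.cong) (auto simp: v_def K_def n_def)
      finally show ?thesis using w[OF that] by simp
    qed
    \<comment> \<open>Coefficients below \<open>n\<close> involve only coefficients of
      \<open>Y\<close> below \<open>n\<close>, which vanish; the degree bound disposes of the
      rest.\<close>
    have "subtree_numer v 1 h = 0"
    proof (rule poly_eqI)
      fix k
      have "coeff (subtree_numer v 1 h) k = fps_nth (Y * fps_of_poly (subtree_denom 1 h)) k"
        unfolding transfer by (simp add: inp_def)
      also have "\<dots> = 0" if "k < n" using that Y by (simp add: fps_mult_nth)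
      finally show "coeff (subtree_numer v 1 h) k = coeff 0 k"
        using degree_subtree_numer[of 1 v h] coeff_eq_0[of "subtree_numer v 1 h" k]
        by (cases "k < n") (auto simp: n_def)
    qed
    then have "v m = 0" if "m \<in> {1..<n + 1}" for m
      using subtree_numer_eq_0[of 1 v h m] that unfolding subtree_1 by (simp add: n_def)
    from this[of "_ + 1"] show "\<forall>r<n. w r = 0" by (simp add: v_def)
  qed
  then show ?thesis
    unfolding structurally_output_controllable_def K_def
    using real_A_realization real_B_realization real_C_realization assms by blast
qed

end
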